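(* Let $A=\{1,\dots,k\}$ with $k$ odd, $k\ge 3$. Let $\alpha=(1\,2\,\dots\,k)\in S_A$ and $\beta=(1\,2)\in S_A$. Then every element of $B(A)$ is realised by $\{\alpha,\beta,TG(2,\alpha,1),TG(2,\beta,1)\}$.
   Context: $\mathbb N=\{1,2,3,\dots\}$. For a nonempty set $A$ and $n,m\in\mathbb N$, $M_{n,m}(A)$ is the set of all maps $f:A^n\to A^m$ (arity $n$, co-arity $m$), $M(A)=\bigcup_{n,m}M_{n,m}(A)$, and $f=(f_1,\dots,f_m)$ in components. $S_A$ is the set of permutations of $A$. For finite $A$, $B_n(A)$ is the set of bijections $A^n\to A^n$ and $B(A)=\bigcup_{n\in\mathbb N}B_n(A)$. Operations on $M(A)$, for $f\in M_{n,s}(A)$, $g\in M_{m,t}(A)$: - $i_1:A\to A$ is the identity (a constant, i.e. nullary operation); - $f\oplus g\in M_{n+m,s+t}(A)$, $(f\oplus g)(x_1,\dots,x_{n+m})=(f_1(x_1,\dots,x_n),\dots,f_s(x_1,\dots,x_n),g_1(x_{n+1},\dots,x_{n+m}),\dots,g_t(x_{n+1},\dots,x_{n+m}))$; - for $k\in\mathbb N$ with $k\le n$ and $k\le t$ (otherwise undefined), $f\circ_k g\in M_{n+m-k,s+t-k}(A)$ has $j$-th component, for $j\le s$, $f_j(g_1(x_1,\dots,x_m),\dots,g_k(x_1,\dots,x_m),x_{m+1},\dots,x_{m+n-k})$, and, for $s<j\le s+t-k$, $g_{k+j-s}(x_1,\dots,x_m)$; - $(\tau f)(x_1,\dots,x_n)=f(x_2,x_1,x_3,\dots,x_n)$,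 $(\zeta f)(x_1,\dots,x_n)=f(x_2,\dots,x_n,x_1)$, with $\tau f=\zeta f=f$ if $n=1$. A Toffoli algebra on $A$ is a subset of $M(A)$ containing $i_1$ and closed under $\oplus,\tau,\zeta$ and all partial operations $\circ_k$, $k\in\mathbb N$. For $F\subseteq M(A)$, $C(F)$ is the smallest Toffoli algebra containing $F$. A mapping $g\in M_{m,n}(A)$ is realised by $F$ if there exist $f\in C(F)\cap M_{l,p}(A)$ (some $l\ge m$, $p\ge n$) and $a_1,\dots,a_{l-m}\in A$ such that $g_i(x_1,\dots,x_m)=f_i(x_1,\dots,x_m,a_1,\dots,a_{l-m})$ for all $i\in\{1,\dots,n\}$ and all $x_1,\dots,x_m\in A$. Toffoli gates: for $\alpha\in S_A$, $o\in A$, $TG(1,\alpha,o)=\alpha$, and for $n\ge2$, $TG(n,\alpha,o)\in B_n(A)$ sends $(x_1,\dots,x_n)$ to $(x_1,\dots,x_{n-1},\alpha(x_n))$ if $x_1=\dots=x_{n-1}=o$, and fixes $(x_1,\dots,x_n)$ otherwise. *)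

theory Defs
  imports "HOL-Library.FuncSet" "HOL-Combinatorics.Cycles" "HOL.Hull"
begin

text \<open>An element of \<open>A\<^sup>n\<close> is a list of length \<open>n\<close> over \<open>A\<close>; the component \<open>x\<^sub>i\<close> is \<open>x ! (i - 1)\<close>.\<close>

definition tuples :: "'a set \<Rightarrow> nat \<Rightarrow> 'a list set"
  where "tuples A n = {x. length x = n \<and> set x \<subseteq> A}"

text \<open>
  A map \<open>A\<^sup>n \<rightarrow> A\<^sup>m\<close> carries its arity and co-arity explicitly, together with a function that is
  extensional on \<open>A\<^sup>n\<close>, so that equality in \<open>maps A n m\<close> is equality of maps.
\<close>

record 'a multimap =
  arity :: nat
  coarity :: nat
  app :: "'a list \<Rightarrow> 'a list"

definition maps :: "'a set \<Rightarrow> nat \<Rightarrow> nat \<Rightarrow> 'a multimap set"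
  where "maps A n m =
    {f. arity f = n \<and> coarity f = m \<and> app f \<in> tuples A n \<rightarrow>\<^sub>E tuples A m}"

definition all_maps :: "'a set \<Rightarrow> 'a multimap set"
  where "all_maps A = (\<Union>n\<in>{1..}. \<Union>m\<in>{1..}. maps A n m)"

definition bijections :: "'a set \<Rightarrow> nat \<Rightarrow> 'a multimap set"
  where "bijections A n = {f \<in> maps A n n. bij_betw (app f) (tuples A n) (tuples A n)}"

definition all_bijections :: "'a set \<Rightarrow> 'a multimap set"
  where "all_bijections A = (\<Union>n\<in>{1..}. bijections A n)"

text \<open>A unary function on \<open>A\<close> as an element of \<open>maps A 1 1\<close>.\<close>

definition unary :: "'a set \<Rightarrow> ('a \<Rightarrow> 'a) \<Rightarrow> 'a multimap"
  where "unary A h = \<lparr>arity = 1, coarity = 1, app = (\<lambda>x\<in>tuples A 1. map h x)\<rparr>"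

definition i1 :: "'a set \<Rightarrow> 'a multimap"
  where "i1 A = unary A id"

definition oplus :: "'a set \<Rightarrow> 'a multimap \<Rightarrow> 'a multimap \<Rightarrow> 'a multimap"
  where "oplus A f g =
    \<lparr>arity = arity f + arity g, coarity = coarity f + coarity g,
     app = (\<lambda>x\<in>tuples A (arity f + arity g).
              app f (take (arity f) x) @ app g (drop (arity f) x))\<rparr>"

text \<open>
  The first \<open>k\<close> outputs of \<open>g\<close> are fed into the first \<open>k\<close> inputs of \<open>f\<close>. Only meaningful for
  \<open>1 \<le> k \<le> min (arity f) (coarity g)\<close>; every use below carries this guard.
\<close>

definition comp_k :: "'a set \<Rightarrow> nat \<Rightarrow> 'a multimap \<Rightarrow> 'a multimap \<Rightarrow> 'a multimap"
  where "comp_k A k f g =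
    \<lparr>arity = arity f + arity g - k, coarity = coarity f + coarity g - k,
     app = (\<lambda>x\<in>tuples A (arity f + arity g - k).
              let y = app g (take (arity g) x)
              in app f (take k y @ drop (arity g) x) @ drop k y)\<rparr>"

fun swap_first :: "'a list \<Rightarrow> 'a list"
  where
    "swap_first (x # y # zs) = y # x # zs"
  | "swap_first xs = xs"

definition tau :: "'a set \<Rightarrow> 'a multimap \<Rightarrow> 'a multimap"
  where "tau A f = f\<lparr>app := (\<lambda>x\<in>tuples A (arity f). app f (swap_first x))\<rparr>"

definition zeta :: "'a set \<Rightarrow> 'a multimap \<Rightarrow> 'a multimap"
  where "zeta A f = f\<lparr>app := (\<lambda>x\<in>tuples A (arity f). app f (rotate1 x))\<rparr>"

definition toffoli_algebra :: "'a set \<Rightarrow> 'a multimap set \<Rightarrow> bool"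
  where "toffoli_algebra A T \<longleftrightarrow>
    T \<subseteq> all_maps A \<and>
    i1 A \<in> T \<and>
    (\<forall>f\<in>T. \<forall>g\<in>T. oplus A f g \<in> T) \<and>
    (\<forall>f\<in>T. tau A f \<in> T) \<and>
    (\<forall>f\<in>T. zeta A f \<in> T) \<and>
    (\<forall>f\<in>T. \<forall>g\<in>T. \<forall>k. 1 \<le> k \<and> k \<le> arity f \<and> k \<le> coarity g \<longrightarrow> comp_k A k f g \<in> T)"

text \<open>
  The smallest Toffoli algebra containing \<open>F\<close>. This is intended for \<open>F \<subseteq> all_maps A\<close> only:
  otherwise there is no such algebra and the hull degenerates to \<open>UNIV\<close>.
\<close>

definition generated :: "'a set \<Rightarrow> 'a multimap set \<Rightarrow> 'a multimap set"
  where "generated A F = toffoli_algebra A hull F"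

definition realised :: "'a set \<Rightarrow> 'a multimap set \<Rightarrow> 'a multimap \<Rightarrow> bool"
  where "realised A F g \<longleftrightarrow>
    g \<in> all_maps A \<and>
    (\<exists>l p. l \<ge> arity g \<and> p \<ge> coarity g \<and>
      (\<exists>f \<in> generated A F \<inter> maps A l p. \<exists>a \<in> tuples A (l - arity g).
        \<forall>x \<in> tuples A (arity g). \<forall>i < coarity g. app g x ! i = app f (x @ a) ! i))"

definition TG :: "'a set \<Rightarrow> nat \<Rightarrow> ('a \<Rightarrow> 'a) \<Rightarrow> 'a \<Rightarrow> 'a multimap"
  where "TG A n h c =
    (if n = 1 then unary A h
     else \<lparr>arity = n, coarity = n,
           app = (\<lambda>x\<in>tuples A n.
                    if \<forall>i < n - 1. x ! i = c then x[n - 1 := h (x ! (n - 1))] else x)\<rparr>)"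

end

theory Submission
  imports Defs
begin

text \<open>
  A realisation may use constant inputs and may leave garbage on its surplus outputs, so it can
  compute irreversibly: copies of the inputs are kept, and no auxiliary wire has to be reset. For a
  fixed number \<open>n\<close> of inputs, a circuit whose other inputs are constants turns an argument
  \<open>x \<in> A\<^sup>n\<close> into a list of wires, each holding a function of \<open>x\<close>. The predicate \<open>reach\<close> describes
  the lists of functions that arise in this way. It is closed under appending constants, under
  permuting the wires (\<open>tau\<close> and \<open>zeta\<close> applied to identities) and under applying any circuit of
  the algebra to an initial segment of the wires (\<open>comp_k\<close>).

  The permutations \<open>\<alpha>\<close> and \<open>\<beta>\<close> generate all transpositions of \<open>A\<close> (\<open>transpose_closed\<close>), hence the
  gates controlled by the value \<open>1\<close> yield every transposition controlled by \<open>1\<close>; relabelling the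
  control wire moves the controlling value, and composing over all values gives every operation
  \<open>(v, w) \<mapsto> (v, transpose (p v) (q v) w)\<close> (\<open>gate2_transpose_family\<close>).

  Such operations are enough to compute everything. On a target wire with the constant \<open>c\<close>, the
  family \<open>transpose c (u v)\<close> writes \<open>u v\<close>; this copies wires and applies arbitrary unary maps. On
  wires that hold truth values, encoded by \<open>t\<close> for true and \<open>s\<close> for false, applying
  \<open>transpose t r\<close> with a third element \<open>r\<close> whenever the control is false leaves \<open>t\<close> on
  the target exactly if both wires are true, so conjunctions are computable and with them the test
  \<open>x = y\<close> for each tuple \<open>y\<close> (\<open>decidable_conj\<close>, \<open>decidable_eq\<close>). A function is then built up from
  a constant by correcting its value at one tuple after the other (\<open>computable_all\<close>). Finally all
  components of a given map are computed side by side and their wires are permuted to the front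
  (\<open>maps_computed\<close>).
\<close>

section \<open>Circuits of a Toffoli algebra as maps on lists of wires\<close>

lemma tuples_append: "x \<in> tuples A n \<Longrightarrow> y \<in> tuples A m \<Longrightarrow> x @ y \<in> tuples A (n + m)"
  by (auto simp: tuples_def)

lemma maps_app: "f \<in> maps A n m \<Longrightarrow> x \<in> tuples A n \<Longrightarrow> app f x \<in> tuples A m"
  by (auto simp: maps_def)

lemma i1_in_maps: "i1 A \<in> maps A 1 1"
  by (auto simp: i1_def unary_def maps_def)

lemma oplus_in_maps:
  assumes "f \<in> maps A n s" "g \<in> maps A m t"
  shows "oplus A f g \<in> maps A (n + m) (s + t)"
proof -
  have "app f (take n x) @ app g (drop n x) \<in> tuples A (s + t)" if "x \<in> tuples A (n + m)" for x
  proof -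
    from that have "take n x \<in> tuples A n" "drop n x \<in> tuples A m"
      using set_take_subset set_drop_subset by (fastforce simp: tuples_def)+
    then show ?thesis by (intro tuples_append maps_app[OF assms(1)] maps_app[OF assms(2)])
  qed
  moreover have "arity f = n" "arity g = m" "coarity f = s" "coarity g = t"
    using assms by (auto simp: maps_def)
  ultimately show ?thesis by (auto simp: oplus_def maps_def)
qed

definition identity :: "'a set \<Rightarrow> nat \<Rightarrow> 'a multimap"
  where "identity A m = \<lparr>arity = m, coarity = m, app = (\<lambda>x\<in>tuples A m. x)\<rparr>"

lemma oplus_identity_i1: "oplus A (identity A m) (i1 A) = identity A (Suc m)"
proof -
  have "(take m x) \<in> tuples A m \<and> drop m x \<in> tuples A 1" if "x \<in> tuples A (Suc m)" for x :: "'a list"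
    using that set_take_subset[of m x] set_drop_subset[of m x] by (auto simp: tuples_def)
  then show ?thesis
    by (auto simp: oplus_def identity_def i1_def unary_def fun_eq_iff restrict_def)
qed

lemma swap_first_in_tuples: "x \<in> tuples A n \<Longrightarrow> swap_first x \<in> tuples A n"
  by (cases x rule: swap_first.cases) (auto simp: tuples_def)

locale circuits =
  fixes A :: "'a set" and T :: "'a multimap set" and n :: nat
  assumes i1_closed: "i1 A \<in> T"
    and oplus_closed: "f \<in> T \<Longrightarrow> g \<in> T \<Longrightarrow> oplus A f g \<in> T"
    and tau_closed: "f \<in> T \<Longrightarrow> tau A f \<in> T"
    and zeta_closed: "f \<in> T \<Longrightarrow> zeta A f \<in> T"
    and comp_closed: "\<lbrakk>f \<in> T; g \<in> T; 1 \<le> k; k \<le> arity f; k \<le> coarity g\<rbrakk> \<Longrightarrow> comp_k A k f g \<in> T"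
    and inputs_pos: "n \<ge> 1"
begin

lemma identity_closed: "identity A (Suc m) \<in> T"
proof (induction m)
  case 0
  have "identity A (Suc 0) = i1 A"
    by (auto simp: identity_def i1_def unary_def)
  then show ?case using i1_closed by simp
next
  case (Suc m)
  then show ?case using oplus_closed[OF Suc i1_closed] by (simp only: oplus_identity_i1)
qed

text \<open>
  The functions on all outputs of one circuit, garbage included; the constants \<open>a\<close> follow the
  \<open>n\<close> proper inputs as in \<open>realised\<close>. The functions are total on lists and only their values on
  \<open>tuples A n\<close> matter, so that \<open>\<lambda>x. x ! i\<close> can serve as the projection.
\<close>

definition reach :: "('a list \<Rightarrow> 'a) list \<Rightarrow> bool"
  where "reach fs \<longleftrightarrow> (\<exists>C\<in>T. \<exists>a. set a \<subseteq> A \<and> C \<in> maps A (n + length a) (length fs) \<and>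
           (\<forall>x\<in>tuples A n. app C (x @ a) = map (\<lambda>f. f x) fs))"

lemma reach_cong:
  assumes "reach fs" "list_all2 (\<lambda>f g. \<forall>x\<in>tuples A n. f x = g x) fs gs"
  shows "reach gs"
proof -
  have "map (\<lambda>f. f x) fs = map (\<lambda>f. f x) gs" if "x \<in> tuples A n" for x
    using assms(2) that by (induction rule: list_all2_induct) auto
  with assms(1) list_all2_lengthD[OF assms(2)] show ?thesis
    by (auto simp: reach_def)
qed

lemma reach_hd_cong:
  "reach (f # fs) \<Longrightarrow> (\<And>x. x \<in> tuples A n \<Longrightarrow> f x = g x) \<Longrightarrow> reach (g # fs)"
  by (erule reach_cong) (auto intro: list_all2_refl)

lemma reach_in:
  assumes "reach fs" "f \<in> set fs" "x \<in> tuples A n"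
  shows "f x \<in> A"
proof -
  obtain C a where C: "set a \<subseteq> A" "C \<in> maps A (n + length a) (length fs)"
    "app C (x @ a) = map (\<lambda>f. f x) fs"
    using assms unfolding reach_def by blast
  have "x @ a \<in> tuples A (n + length a)"
    using assms(3) C(1) by (auto simp: tuples_def)
  from maps_app[OF C(2) this] show ?thesis
    using assms(2) by (auto simp: C(3) tuples_def)
qed

text \<open>
  \<open>comp_k\<close> with \<open>k\<close> equal to the full arity of \<open>D\<close> consumes the first \<open>k\<close> wires and passes
  the others through, so no padding of \<open>D\<close> by identities is required.
\<close>

lemma reach_apply:
  assumes "reach (us @ rest)" "us \<noteq> []" and D: "D \<in> T" "D \<in> maps A (length us) (length ws)"
    and out: "\<And>x. x \<in> tuples A n \<Longrightarrow> (\<forall>f\<in>set us. f x \<in> A)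
                \<Longrightarrow> app D (map (\<lambda>f. f x) us) = map (\<lambda>f. f x) ws"
  shows "reach (ws @ rest)"
proof -
  let ?k = "length us"
  obtain C a where C: "C \<in> T" "set a \<subseteq> A" "C \<in> maps A (n + length a) (length (us @ rest))"
    and eq: "\<And>x. x \<in> tuples A n \<Longrightarrow> app C (x @ a) = map (\<lambda>f. f x) (us @ rest)"
    using assms(1) unfolding reach_def by blast
  have ar: "arity C = n + length a" "coarity C = length us + length rest"
    "arity D = ?k" "coarity D = length ws"
    using C D by (auto simp: maps_def)
  let ?E = "comp_k A ?k D C"
  have "?E \<in> T"
    using comp_closed[OF D(1) C(1), of ?k] assms(2) ar by (simp add: Suc_leI)
  moreover have "?E \<in> maps A (n + length a) (length (ws @ rest))"
  proof -
    have "app D (take ?k (app C y)) @ drop ?k (app C y) \<in> tuples A (length (ws @ rest))"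
      if "y \<in> tuples A (n + length a)" for y
    proof -
      have "app C y \<in> tuples A (length (us @ rest))" using maps_app[OF C(3) that] .
      then have "take ?k (app C y) \<in> tuples A ?k" "drop ?k (app C y) \<in> tuples A (length rest)"
        using set_take_subset set_drop_subset by (fastforce simp: tuples_def)+
      then show ?thesis
        using tuples_append[OF maps_app[OF D(2)]] by auto
    qed
    then show ?thesis
      by (auto simp: maps_def comp_k_def ar Let_def tuples_def)
  qed
  moreover have "app ?E (x @ a) = map (\<lambda>f. f x) (ws @ rest)" if x: "x \<in> tuples A n" for x
  proof -
    have "x @ a \<in> tuples A (n + length a)"
      using x C(2) by (auto simp: tuples_def)
    moreover have "length x = n" using x by (simp add: tuples_def)
    moreover have "app D (map (\<lambda>f. f x) us) = map (\<lambda>f. f x) ws"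
      using out[OF x] reach_in[OF assms(1) _ x] by auto
    ultimately show ?thesis
      by (simp add: comp_k_def ar Let_def eq[OF x])
  qed
  ultimately show ?thesis
    using C(2) unfolding reach_def by blast
qed

text \<open>
  \<open>tau\<close> and \<open>zeta\<close> only permute inputs, but on an identity map that is the same as permuting
  outputs. The resulting wire permutations, a rotation and the swap of the first two wires,
  generate all permutations of the wires.
\<close>

lemma reach_rotate1:
  assumes "reach fs" "fs \<noteq> []"
  shows "reach (rotate1 fs)"
proof -
  obtain m where m: "length fs = Suc m" using assms(2) by (cases fs) auto
  let ?D = "zeta A (identity A (Suc m))"
  have rot: "x \<in> tuples A k \<Longrightarrow> rotate1 x \<in> tuples A k" for x :: "'a list" and k
    by (auto simp: tuples_def)
  have "?D \<in> T" by (intro zeta_closed identity_closed)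
  moreover have "?D \<in> maps A (length fs) (length (rotate1 fs))"
    using rot by (auto simp: zeta_def identity_def maps_def m)
  moreover have "app ?D (map (\<lambda>f. f x) fs) = map (\<lambda>f. f x) (rotate1 fs)"
    if "\<forall>f\<in>set fs. f x \<in> A" for x
  proof -
    have "map (\<lambda>f. f x) fs \<in> tuples A (Suc m)" using that m by (auto simp: tuples_def)
    then show ?thesis using rot[of "map (\<lambda>f. f x) fs"] by (simp add: zeta_def identity_def rotate1_map)
  qed
  ultimately show ?thesis
    using reach_apply[of fs "[]" ?D "rotate1 fs"] assms by simp
qed

lemma reach_swap_first:
  assumes "reach (f # g # fs)"
  shows "reach (g # f # fs)"
proof -
  let ?D = "tau A (identity A (Suc 1))"
  have "?D \<in> T" by (intro tau_closed identity_closed)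
  moreover have "?D \<in> maps A 2 2"
    using swap_first_in_tuples[of _ A "Suc 1"] by (auto simp: tau_def identity_def maps_def numeral_2_eq_2)
  moreover have "app ?D [f x, g x] = [g x, f x]" if "f x \<in> A" "g x \<in> A" for x
  proof -
    have "[f x, g x] \<in> tuples A 2" "[g x, f x] \<in> tuples A 2" using that by (auto simp: tuples_def)
    then show ?thesis by (simp add: tau_def identity_def numeral_2_eq_2)
  qed
  ultimately show ?thesis
    using reach_apply[of "[f, g]" fs ?D "[g, f]"] assms by (simp add: numeral_2_eq_2)
qed

lemma reach_rotate:
  assumes "reach (us @ vs)"
  shows "reach (vs @ us)"
  using assms
proof (induction us arbitrary: vs)
  case (Cons u us)
  from reach_rotate1[OF Cons.prems] have "reach (us @ (vs @ [u]))" by simp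
  from Cons.IH[OF this] show ?case by simp
qed simp

lemma reach_to_front:
  assumes "reach (us @ f # vs)"
  shows "reach (f # us @ vs)"
  using assms
proof (induction us arbitrary: vs rule: rev_induct)
  case (snoc u us)
  from snoc.prems have "reach (us @ ([u, f] @ vs))" by simp
  then have "reach (u # f # vs @ us)" by (drule_tac reach_rotate) simp
  then have "reach ((f # u # vs) @ us)" by (drule_tac reach_swap_first) simp
  then have "reach (us @ f # (u # vs))" by (drule_tac reach_rotate) simp
  from snoc.IH[OF this] show ?case by simp
qed simp

text \<open>
  Selection sort: each induction step fixes the next wire and moves it into the prefix \<open>pre\<close>,
  which has to be general because wires can only be brought to the front of the whole list.
\<close>

lemma reach_perm_aux:
  assumes "reach (pre @ fs)" "mset fs = mset gs"
  shows "reach (pre @ gs)"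
  using assms
proof (induction gs arbitrary: pre fs)
  case (Cons g gs)
  have "g \<in> set fs" using Cons.prems(2) by (metis list.set_intros(1) mset_eq_setD)
  then obtain us vs where fs: "fs = us @ g # vs" by (meson split_list)
  have "reach (us @ g # (vs @ pre))"
    using reach_rotate[of pre fs] Cons.prems(1) by (simp add: fs)
  from reach_to_front[OF this] have "reach ((g # us @ vs) @ pre)" by simp
  from reach_rotate[OF this] have "reach ((pre @ [g]) @ (us @ vs))" by simp
  from Cons.IH[OF this] show ?case using Cons.prems(2) by (simp add: fs)
qed simp

lemma reach_perm: "reach fs \<Longrightarrow> mset fs = mset gs \<Longrightarrow> reach gs"
  using reach_perm_aux[of "[]" fs gs] by simp

lemma reach_inputs: "reach (map (\<lambda>i x. x ! i) [0..<n])"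
proof -
  obtain m where m: "n = Suc m" using inputs_pos by (cases n) auto
  have "identity A n \<in> maps A n n" by (auto simp: identity_def maps_def)
  moreover have "app (identity A n) x = map (\<lambda>f. f x) (map (\<lambda>i x. x ! i) [0..<n])"
    if "x \<in> tuples A n" for x
    using that map_nth[of x] by (simp add: identity_def comp_def) (simp add: tuples_def)
  ultimately show ?thesis
    using identity_closed[of m] unfolding reach_def
    by (intro bexI[of _ "identity A n"] exI[of _ "[]"]) (auto simp: m)
qed

lemma reach_const:
  assumes "reach fs" "c \<in> A"
  shows "reach ((\<lambda>_. c) # fs)"
proof -
  obtain C a where C: "C \<in> T" "set a \<subseteq> A" "C \<in> maps A (n + length a) (length fs)"
    and eq: "\<And>x. x \<in> tuples A n \<Longrightarrow> app C (x @ a) = map (\<lambda>f. f x) fs"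
    using assms(1) unfolding reach_def by blast
  let ?E = "oplus A C (i1 A)"
  have "?E \<in> T" using oplus_closed[OF C(1) i1_closed] .
  moreover have "?E \<in> maps A (n + length (a @ [c])) (length (fs @ [\<lambda>_. c]))"
    using oplus_in_maps[OF C(3) i1_in_maps] by simp
  moreover have "app ?E (x @ (a @ [c])) = map (\<lambda>f. f x) (fs @ [\<lambda>_. c])" if x: "x \<in> tuples A n" for x
  proof -
    have "x @ a @ [c] \<in> tuples A (Suc (n + length a))" "[c] \<in> tuples A (Suc 0)" "length x = n"
      using x C(2) assms(2) by (auto simp: tuples_def)
    moreover have "arity C = n + length a" using C(3) by (simp add: maps_def)
    ultimately show ?thesis
      using eq[OF x] by (simp add: oplus_def i1_def unary_def)
  qed
  ultimately have "reach (fs @ [\<lambda>_. c])"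
    unfolding reach_def using C(2) assms(2)
    by (intro bexI[of _ ?E] exI[of _ "a @ [c]"]) auto
  then show ?thesis by (rule reach_perm) simp
qed

section \<open>Controlled permutations\<close>

text \<open>
  By stating the gates on the first wires, for arbitrary contents of the wires, composing gates
  becomes chaining of implications, and \<open>reach_perm\<close> carries them to any other position.
\<close>

definition gate1 :: "('a \<Rightarrow> 'a) \<Rightarrow> bool"
  where "gate1 \<sigma> \<longleftrightarrow> (\<forall>f fs. reach (f # fs) \<longrightarrow> reach ((\<lambda>x. \<sigma> (f x)) # fs))"

definition gate2 :: "('a \<Rightarrow> 'a \<Rightarrow> 'a) \<Rightarrow> bool"
  where "gate2 h \<longleftrightarrow> (\<forall>f g fs. reach (f # g # fs) \<longrightarrow> reach (f # (\<lambda>x. h (f x) (g x)) # fs))"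

lemma gate1_unary:
  assumes "unary A \<sigma> \<in> T" "\<sigma> ` A \<subseteq> A"
  shows "gate1 \<sigma>"
  unfolding gate1_def
proof (intro allI impI)
  fix f fs assume r: "reach (f # fs)"
  have "unary A \<sigma> \<in> maps A 1 1"
    using assms(2) by (fastforce simp: unary_def maps_def tuples_def)
  then show "reach ((\<lambda>x. \<sigma> (f x)) # fs)"
    using reach_apply[of "[f]" fs "unary A \<sigma>" "[\<lambda>x. \<sigma> (f x)]"] r assms(1)
    by (simp add: unary_def tuples_def)
qed

lemma gate2_TG:
  assumes "TG A 2 \<sigma> c \<in> T" "\<sigma> ` A \<subseteq> A"
  shows "gate2 (\<lambda>v. if v = c then \<sigma> else id)"
  unfolding gate2_def
proof (intro allI impI)
  fix f g fs assume r: "reach (f # g # fs)"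
  let ?D = "TG A 2 \<sigma> c" and ?g = "\<lambda>x. (if f x = c then \<sigma> else id) (g x)"
  have val: "app ?D [v, w] = [v, (if v = c then \<sigma> else id) w]" if "v \<in> A" "w \<in> A" for v w
    using that by (simp add: TG_def tuples_def)
  have "app ?D x \<in> tuples A 2" if x: "x \<in> tuples A 2" for x
  proof -
    obtain v w where "x = [v, w]" "v \<in> A" "w \<in> A"
      using x by (auto simp: tuples_def numeral_2_eq_2 length_Suc_conv)
    then show ?thesis using val assms(2) by (auto simp: tuples_def)
  qed
  then have "?D \<in> maps A 2 2"
    unfolding maps_def by (auto simp: TG_def)
  then show "reach (f # ?g # fs)"
    using reach_apply[of "[f, g]" fs ?D "[f, ?g]"] r assms(1) val
    by (simp add: numeral_2_eq_2)
qed

lemma gate2D: "gate2 h \<Longrightarrow> reach (f # g # fs) \<Longrightarrow> reach (f # (\<lambda>x. h (f x) (g x)) # fs)"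
  by (simp add: gate2_def)

lemma gate1_comp: "gate1 \<sigma> \<Longrightarrow> gate1 \<rho> \<Longrightarrow> gate1 (\<sigma> \<circ> \<rho>)"
  by (simp add: gate1_def)

lemma gate2_comp: "gate2 h \<Longrightarrow> gate2 h' \<Longrightarrow> gate2 (\<lambda>v. h v \<circ> h' v)"
  by (simp add: gate2_def)

lemma gate2_id: "gate2 (\<lambda>v. id)"
  by (simp add: gate2_def)

text \<open>Wires hold elements of \<open>A\<close> only, hence the behaviour of \<open>h\<close> at other controls is immaterial.\<close>

lemma gate2_cong:
  assumes "gate2 h" "\<And>v. v \<in> A \<Longrightarrow> h v = h' v"
  shows "gate2 h'"
  unfolding gate2_def
proof (intro allI impI)
  fix f g fs assume r: "reach (f # g # fs)"
  then have "reach (f # (\<lambda>x. h (f x) (g x)) # fs)" using assms(1) by (auto simp: gate2_def)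
  then show "reach (f # (\<lambda>x. h' (f x) (g x)) # fs)"
    by (rule reach_cong) (auto intro: list_all2_refl simp: assms(2) reach_in[OF r])
qed

text \<open>
  Relabel the control by \<open>\<sigma>\<close>, apply the gate, relabel back. Asking \<open>\<sigma>\<close> to be an involution avoids
  inverse gates.
\<close>

lemma gate2_conjugate:
  assumes h: "gate2 h" and \<sigma>: "gate1 \<sigma>" "\<And>v. \<sigma> (\<sigma> v) = v"
  shows "gate2 (\<lambda>v. h (\<sigma> v))"
  unfolding gate2_def
proof (intro allI impI)
  fix f g fs assume "reach (f # g # fs)"
  then have "reach ((\<lambda>x. \<sigma> (f x)) # g # fs)" using \<sigma>(1) by (simp add: gate1_def)
  then have "reach ((\<lambda>x. \<sigma> (f x)) # (\<lambda>x. h (\<sigma> (f x)) (g x)) # fs)" using h by (simp add: gate2_def)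
  then have "reach ((\<lambda>x. \<sigma> (\<sigma> (f x))) # (\<lambda>x. h (\<sigma> (f x)) (g x)) # fs)"
    using \<sigma>(1) by (simp add: gate1_def)
  then show "reach (f # (\<lambda>x. h (\<sigma> (f x)) (g x)) # fs)" by (simp add: \<sigma>(2))
qed

end

text \<open>
  Transpositions, plain and controlled by one fixed value \<open>c\<close>, are all that the universality
  argument uses of a gate set. The bound of three elements is essential: over two elements
  the controlled transposition is addition modulo \<open>2\<close> and only affine functions are computable.
\<close>

locale transposition_circuits = circuits A T n
  for A :: "'a set" and T n +
  fixes c :: 'a
  assumes finite_A: "finite A" and card_A: "card A \<ge> 3" and c_in: "c \<in> A"
    and gate1_transpose: "a \<in> A \<Longrightarrow> b \<in> A \<Longrightarrow> gate1 (transpose a b)"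
    and gate2_transpose: "a \<in> A \<Longrightarrow> b \<in> A \<Longrightarrow> gate2 (\<lambda>v. if v = c then transpose a b else id)"
begin

lemma gate2_transpose_at:
  assumes "d \<in> A" "a \<in> A" "b \<in> A"
  shows "gate2 (\<lambda>v. if v = d then transpose a b else id)"
proof -
  have "gate2 (\<lambda>v. if transpose c d v = c then transpose a b else id)"
    using gate2_conjugate[OF gate2_transpose[OF assms(2,3)] gate1_transpose[OF c_in assms(1)]]
    by simp
  moreover have "transpose c d v = c \<longleftrightarrow> v = d" for v
    by (auto simp: transpose_def)
  ultimately show ?thesis by simp
qed

text \<open>
  At every control at most one factor of the composition over \<open>v \<in> A\<close> acts, so the order of the
  factors does not matter. The maps \<open>p\<close> and \<open>q\<close> may coincide at \<open>v\<close>: then nothing happens.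
\<close>

lemma gate2_transpose_family:
  assumes "p ` A \<subseteq> A" "q ` A \<subseteq> A"
  shows "gate2 (\<lambda>v. transpose (p v) (q v))"
proof -
  have "gate2 (\<lambda>v. if v \<in> S then transpose (p v) (q v) else id)" if "finite S" "S \<subseteq> A" for S
    using that
  proof (induction S rule: finite_induct)
    case empty
    show ?case using gate2_id by (simp only: empty_iff if_False)
  next
    case (insert s S)
    have "gate2 (\<lambda>v. (if v = s then transpose (p s) (q s) else id) \<circ>
                     (if v \<in> S then transpose (p v) (q v) else id))"
      using insert assms by (intro gate2_comp gate2_transpose_at insert.IH) auto
    then show ?case
      by (rule gate2_cong) (use insert.hyps in auto)
  qed
  from this[OF finite_A subset_refl] show ?thesis
    by (rule gate2_cong) simp
qed

section \<open>Every finite function is computable with constants and garbage\<close>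

text \<open>
  \<open>f\<close> can be added to every circuit that still carries its inputs. Keeping all old wires \<open>fs\<close>
  is what makes the notion compositional: several functions can be computed one after another.
\<close>

definition computable :: "('a list \<Rightarrow> 'a) \<Rightarrow> bool"
  where "computable f \<longleftrightarrow> (\<forall>fs. reach fs \<and> (\<forall>i<n. (\<lambda>x. x ! i) \<in> set fs) \<longrightarrow> (\<exists>gs. reach (f # gs @ fs)))"

lemma computable_cong:
  assumes "computable f" "\<And>x. x \<in> tuples A n \<Longrightarrow> f x = g x"
  shows "computable g"
  unfolding computable_def
proof (intro allI impI)
  fix fs assume "reach fs \<and> (\<forall>i<n. (\<lambda>x. x ! i) \<in> set fs)"
  then obtain gs where "reach (f # gs @ fs)" using assms(1) unfolding computable_def by blast
  from reach_hd_cong[OF this assms(2)] show "\<exists>gs. reach (g # gs @ fs)" by blast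
qed

lemma computable_const: "a \<in> A \<Longrightarrow> computable (\<lambda>_. a)"
  unfolding computable_def using reach_const by (metis append_Nil)

text \<open>
  Both arguments sit on fresh wires when the gate acts, so overwriting \<open>g\<close> destroys no wire of
  \<open>fs\<close>; the wire of \<open>f\<close> becomes garbage.
\<close>

lemma computable_gate2:
  assumes "computable f" "computable g" "gate2 h"
  shows "computable (\<lambda>x. h (f x) (g x))"
  unfolding computable_def
proof (intro allI impI)
  fix fs assume fs: "reach fs \<and> (\<forall>i<n. (\<lambda>x. x ! i) \<in> set fs)"
  then obtain gs where gs: "reach (f # gs @ fs)" using assms(1) unfolding computable_def by blast
  with fs have "reach (f # gs @ fs) \<and> (\<forall>i<n. (\<lambda>x. x ! i) \<in> set (f # gs @ fs))" by simp
  then obtain gs' where "reach (g # gs' @ f # gs @ fs)" using assms(2) unfolding computable_def by blast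
  then have "reach (f # g # gs' @ gs @ fs)" by (rule reach_perm) simp
  then have "reach (f # (\<lambda>x. h (f x) (g x)) # gs' @ gs @ fs)"
    using assms(3) by (simp add: gate2_def)
  then have "reach ((\<lambda>x. h (f x) (g x)) # (f # gs' @ gs) @ fs)"
    by (rule reach_perm) simp
  then show "\<exists>gs. reach ((\<lambda>x. h (f x) (g x)) # gs @ fs)" by blast
qed

text \<open>
  Fan-out: the input wire controls \<open>transpose c v\<close> on a fresh wire with the constant \<open>c\<close>, which receives
  \<open>v\<close> while the input stays in place.
\<close>

lemma computable_input:
  assumes "i < n"
  shows "computable (\<lambda>x. x ! i)"
  unfolding computable_def
proof (intro allI impI)
  fix fs assume fs: "reach fs \<and> (\<forall>i<n. (\<lambda>x. x ! i) \<in> set fs)"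
  let ?p = "\<lambda>x. x ! i"
  obtain us vs where split: "fs = us @ ?p # vs" using fs assms by (meson split_list)
  have "reach ((\<lambda>_. c) # fs)" using fs c_in by (intro reach_const) auto
  then have "reach (?p # (\<lambda>_. c) # us @ vs)" by (rule reach_perm) (simp add: split)
  moreover have "gate2 (\<lambda>v. transpose c v)"
    using gate2_transpose_family[of "\<lambda>_. c" "\<lambda>v. v"] c_in by auto
  ultimately have "reach (?p # (\<lambda>x. transpose c (?p x) c) # us @ vs)" using gate2D by blast
  then have "reach (?p # ?p # us @ vs)" by simp
  then have "reach (?p # [] @ fs)" by (rule reach_perm) (simp add: split)
  then show "\<exists>gs. reach (?p # gs @ fs)" by blast
qed

lemma computable_unary:
  assumes "computable f" "u ` A \<subseteq> A"
  shows "computable (\<lambda>x. u (f x))"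
proof -
  have "gate2 (\<lambda>v. transpose c (u v))"
    using gate2_transpose_family[of "\<lambda>_. c" u] assms(2) c_in by auto
  from computable_gate2[OF assms(1) computable_const[OF c_in] this]
  show ?thesis by simp
qed

text \<open>
  Truth values have no fixed encoding: any two elements of \<open>A\<close> may represent them, since unary
  maps recode freely.
\<close>

definition decidable :: "('a list \<Rightarrow> bool) \<Rightarrow> bool"
  where "decidable P \<longleftrightarrow> (\<forall>a\<in>A. \<forall>b\<in>A. computable (\<lambda>x. if P x then a else b))"

lemma decidable_True: "decidable (\<lambda>_. True)"
  using computable_const by (simp add: decidable_def)

lemma decidable_input_eq: "i < n \<Longrightarrow> decidable (\<lambda>x. x ! i = v)"
  unfolding decidable_def
  using computable_unary[OF computable_input[of i], of "\<lambda>w. if w = v then _ else _"] by auto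

text \<open>
  Encode true by \<open>t\<close> and false by \<open>s\<close>, and apply \<open>transpose t r\<close> to the wire of \<open>Q\<close> if \<open>P\<close> is false. Then
  that wire holds \<open>t\<close> if both hold, \<open>s\<close> if \<open>Q\<close> fails, and \<open>r\<close> if only \<open>P\<close> fails. With
  only two elements no permutation could send both truth values of \<open>Q\<close> to values other than \<open>t\<close>.
  A unary map merges \<open>s\<close> and \<open>r\<close> afterwards.
\<close>

lemma decidable_conj:
  assumes P: "decidable P" and Q: "decidable Q"
  shows "decidable (\<lambda>x. P x \<and> Q x)"
  unfolding decidable_def
proof (intro ballI)
  fix a b assume ab: "a \<in> A" "b \<in> A"
  obtain t s r where tsr: "t \<in> A" "s \<in> A" "r \<in> A" "t \<noteq> s" "t \<noteq> r" "s \<noteq> r"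
  proof -
    obtain B where "B \<subseteq> A" "card B = 3" using card_A obtain_subset_with_card_n by metis
    then show thesis using that by (auto simp: card_3_iff)
  qed
  have "gate2 (\<lambda>v. transpose t (if v = t then t else r))"
    using gate2_transpose_family[of "\<lambda>_. t" "\<lambda>v. if v = t then t else r"] tsr by auto
  moreover have "computable (\<lambda>x. if P x then t else s)" "computable (\<lambda>x. if Q x then t else s)"
    using P Q tsr by (auto simp: decidable_def)
  ultimately have "computable (\<lambda>x. transpose t (if (if P x then t else s) = t then t else r)
      (if Q x then t else s))" (is "computable ?f")
    using computable_gate2[of _ _ "\<lambda>v. transpose t (if v = t then t else r)"] by blast
  then have "computable (\<lambda>x. if ?f x = t then a else b)"
    using computable_unary[of ?f "\<lambda>w. if w = t then a else b"] ab by auto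
  then show "computable (\<lambda>x. if P x \<and> Q x then a else b)"
    by (rule computable_cong) (use tsr in \<open>auto simp: transpose_def\<close>)
qed

lemma decidable_eq:
  assumes "y \<in> tuples A n"
  shows "decidable (\<lambda>x. \<forall>i<n. x ! i = y ! i)"
proof -
  have "decidable (\<lambda>x. \<forall>i<m. x ! i = y ! i)" if "m \<le> n" for m
    using that
  proof (induction m)
    case 0
    show ?case using decidable_True by simp
  next
    case (Suc m)
    then show ?case
      using decidable_conj[OF decidable_input_eq[of m] Suc.IH] by (simp add: All_less_Suc)
  qed
  then show ?thesis by simp
qed

text \<open>
  Start with the constant \<open>c\<close> and treat the tuples \<open>y\<close> one at a time: before its turn the
  accumulator holds \<open>c\<close> at \<open>y\<close>, so \<open>transpose c (g y)\<close>, controlled by the test \<open>x = y\<close>,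
  writes \<open>g y\<close> there and changes no other value.
\<close>

lemma computable_all:
  assumes "\<And>x. x \<in> tuples A n \<Longrightarrow> g x \<in> A"
  shows "computable g"
proof -
  have "\<not> A \<subseteq> {c}" using card_A card_mono[of "{c}" A] by auto
  then obtain d where d: "d \<in> A" "d \<noteq> c" by blast
  have "computable (\<lambda>x. if x \<in> S then g x else c)" if "finite S" "S \<subseteq> tuples A n" for S
    using that
  proof (induction S rule: finite_induct)
    case empty
    show ?case using computable_const[OF c_in] by simp
  next
    case (insert y S)
    have y: "y \<in> tuples A n" "g y \<in> A" using insert.prems assms by auto
    \<comment> \<open>Here \<open>c\<close> encodes true, and on false the family contributes \<open>transpose c c\<close>, the identity.\<close>
    let ?is_y = "\<lambda>x. if \<forall>i<n. x ! i = y ! i then c else d"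
    let ?h = "\<lambda>v. transpose c (if v = c then g y else c)"
    have "computable ?is_y" using decidable_eq[OF y(1)] c_in d(1) by (auto simp: decidable_def)
    moreover have "gate2 ?h"
      using gate2_transpose_family[of "\<lambda>_. c" "\<lambda>v. if v = c then g y else c"] y(2) c_in by auto
    ultimately have "computable (\<lambda>x. ?h (?is_y x) (if x \<in> S then g x else c))"
      using computable_gate2[of ?is_y _ ?h] insert by blast
    then show ?case
    proof (rule computable_cong)
      fix x assume "x \<in> tuples A n"
      then have "(\<forall>i<n. x ! i = y ! i) \<longleftrightarrow> x = y"
        using y(1) by (auto simp: tuples_def list_eq_iff_nth_eq)
      then show "?h (?is_y x) (if x \<in> S then g x else c) = (if x \<in> insert y S then g x else c)"
        using insert.hyps d(2) by auto
    qed
  qed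
  moreover have "finite (tuples A n)"
    using finite_lists_length_eq[OF finite_A, of n] by (simp add: tuples_def conj_commute)
  ultimately have "computable (\<lambda>x. if x \<in> tuples A n then g x else c)" by blast
  then show ?thesis by (rule computable_cong) simp
qed

lemma reach_computables:
  assumes "\<And>f. f \<in> set fs \<Longrightarrow> computable f"
  shows "\<exists>gs. reach (fs @ gs) \<and> (\<forall>i<n. (\<lambda>x. x ! i) \<in> set gs)"
  using assms
proof (induction fs)
  case Nil
  show ?case using reach_inputs by (intro exI[of _ "map (\<lambda>i x. x ! i) [0..<n]"]) auto
next
  case (Cons f fs)
  then obtain gs where gs: "reach (fs @ gs)" "\<forall>i<n. (\<lambda>x. x ! i) \<in> set gs" by auto
  then have "\<forall>i<n. (\<lambda>x. x ! i) \<in> set (fs @ gs)" by simp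
  then obtain hs where "reach (f # hs @ fs @ gs)"
    using Cons.prems[of f] gs(1) unfolding computable_def by auto
  then have "reach ((f # fs) @ (hs @ gs))" by (rule reach_perm) simp
  then show ?case using gs(2) by (intro exI[of _ "hs @ gs"]) auto
qed

text \<open>The conclusion is the existential part of \<open>realised\<close>, for the algebra \<open>T\<close>.\<close>

lemma maps_computed:
  assumes g: "g \<in> maps A n m"
  shows "\<exists>l p. l \<ge> n \<and> p \<ge> m \<and> (\<exists>f \<in> T \<inter> maps A l p. \<exists>a \<in> tuples A (l - n).
        \<forall>x \<in> tuples A n. \<forall>i < m. app g x ! i = app f (x @ a) ! i)"
proof -
  let ?fs = "map (\<lambda>i x. app g x ! i) [0..<m]"
  have "app g x ! i \<in> A" if "x \<in> tuples A n" "i < m" for x i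
    using maps_app[OF g that(1)] that(2) nth_mem[of i "app g x"] by (auto simp: tuples_def)
  then have "computable f" if "f \<in> set ?fs" for f
    using that computable_all[of f] by auto
  then obtain gs where "reach (?fs @ gs)" using reach_computables[of ?fs] by blast
  then obtain C a where C: "C \<in> T" "set a \<subseteq> A" "C \<in> maps A (n + length a) (length (?fs @ gs))"
    "\<And>x. x \<in> tuples A n \<Longrightarrow> app C (x @ a) = map (\<lambda>f. f x) (?fs @ gs)"
    unfolding reach_def by blast
  show ?thesis
    by (rule exI[of _ "n + length a"], rule exI[of _ "length (?fs @ gs)"], intro conjI bexI[of _ C] bexI[of _ a])
       (use C in \<open>auto simp: tuples_def nth_append\<close>)
qed

end

section \<open>Generating the transpositions\<close>

lemma conjugate_transpose:
  assumes "q \<circ> p = id" "p \<circ> q = id"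
  shows "p \<circ> transpose a b \<circ> q = transpose (p a) (p b)"
proof
  fix x
  have "p (q x) = x" "q (p y) = y" for y using assms by (metis comp_apply id_apply)+
  then show "(p \<circ> transpose a b \<circ> q) x = transpose (p a) (p b) x"
    by (auto simp: transpose_def)
qed

text \<open>
  The symmetric group on \<open>{1..k}\<close> is generated by the long cycle and \<open>transpose 1 2\<close>, phrased for
  any predicate closed under composition so that it applies to plain and to controlled gates
  alike. Conjugating this transposition by powers of the cycle gives the adjacent transpositions,
  these give \<open>transpose 1 i\<close> by induction, and \<open>transpose 1 a\<close> conjugates \<open>transpose 1 b\<close> into
  \<open>transpose a b\<close>. The cycle has finite order, so its inverse is one of its powers and closure
  under composition suffices.
\<close>

lemma transpose_closed:
  fixes k :: nat
  assumes cl: "\<And>p q. S p \<Longrightarrow> S q \<Longrightarrow> S (p \<circ> q)"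
    and \<alpha>: "S (cycle_of_list [1..<k + 1])" and \<beta>: "S (cycle_of_list [1, 2])"
    and k: "k \<ge> 2" and a: "a \<in> {1..k}" and b: "b \<in> {1..k}"
  shows "S (transpose a b)"
proof -
  let ?\<alpha> = "cycle_of_list [1..<k + 1]"
  have swap: "S (transpose 1 2)"
    using \<beta> by simp
  have order: "?\<alpha> ^^ k = id"
    using cycle_is_id_root[of "[1..<k + 1]"] by (simp del: upt_Suc)
  have "S (?\<alpha> ^^ Suc m)" for m
    by (induction m) (use \<alpha> cl in \<open>auto simp: comp_def\<close>)
  then have pow: "S (?\<alpha> ^^ m)" if "m > 0" for m
    using that by (metis gr0_implies_Suc)
  have "S id" using pow[of k] order k by simp
  have conj: "S (transpose (p x) (p y))" if "S p" "S q" "q \<circ> p = id" "p \<circ> q = id" "S (transpose x y)" for p q x y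
    using conjugate_transpose[OF that(3,4), of x y] cl that by metis
  have val: "(?\<alpha> ^^ i) (Suc j) = Suc (i + j)" if "i + j < k" for i j
  proof -
    have "map (?\<alpha> ^^ i) [1..<k + 1] ! j = rotate i [1..<k + 1] ! j"
      using cyclic_rotation[of "[1..<k + 1]" i] by (simp del: upt_Suc)
    then show ?thesis using that by (simp add: nth_rotate del: upt_Suc)
  qed
  have adjacent: "S (transpose i (Suc i))" if "1 \<le> i" "i < k" for i
  proof (cases "i = 1")
    case True then show ?thesis using swap by (simp add: numeral_2_eq_2)
  next
    case False
    define j where "j = i - 1"
    have j: "i = Suc j" "j > 0" using that False by (auto simp: j_def)
    have "(?\<alpha> ^^ (k - j)) \<circ> (?\<alpha> ^^ j) = id" "(?\<alpha> ^^ j) \<circ> (?\<alpha> ^^ (k - j)) = id"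
      using order that j by (simp_all add: funpow_add[symmetric])
    then have "S (transpose ((?\<alpha> ^^ j) 1) ((?\<alpha> ^^ j) 2))"
      using that j by (intro conj[of _ "?\<alpha> ^^ (k - j)", OF pow pow _ _ swap]) simp_all
    then show ?thesis using val[of j 0] val[of j 1] that j by (simp add: numeral_2_eq_2)
  qed
  have first: "S (transpose 1 i)" if "1 \<le> i" "i \<le> k" for i
    using that
  proof (induction i rule: dec_induct)
    case base
    show ?case using \<open>S id\<close> by (simp add: id_def)
  next
    case (step i)
    let ?t = "transpose i (Suc i)"
    show ?case
    proof (cases "i = 1")
      case True then show ?thesis using swap by (simp add: numeral_2_eq_2)
    next
      case False
      have "S (transpose (?t 1) (?t i))"
        using step by (intro conj[OF adjacent adjacent]) auto
      then show ?thesis using False step by simp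
    qed
  qed
  show ?thesis
  proof (cases "b = 1")
    case True then show ?thesis using first[of a] a by (simp add: transpose_commute)
  next
    case False
    let ?t = "transpose 1 a"
    show ?thesis
    proof (cases "a = b")
      case True then show ?thesis using \<open>S id\<close> by (simp add: id_def)
    next
      case ne: False
      have "S (transpose (?t 1) (?t b))"
        using a b first by (intro conj[of ?t ?t]) auto
      then show ?thesis using False ne by simp
    qed
  qed
qed

section \<open>Universality\<close>

lemma circuits_generated: "n \<ge> 1 \<Longrightarrow> circuits A (generated A F) n"
  by unfold_locales (auto simp: generated_def hull_def toffoli_algebra_def)

theorem corollary5p12:
  fixes k :: nat and A :: "nat set" and \<alpha> \<beta> :: "nat \<Rightarrow> nat"
  assumes "odd k" and "k \<ge> 3"
    and "A = {1..k}"
    and "\<alpha> = cycle_of_list [1..<k + 1]"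
    and "\<beta> = cycle_of_list [1, 2]"
  shows "\<forall>g \<in> all_bijections A.
    realised A {unary A \<alpha>, unary A \<beta>, TG A 2 \<alpha> 1, TG A 2 \<beta> 1} g"
proof
  fix g assume "g \<in> all_bijections A"
  then obtain n where n: "n \<ge> 1" and g: "g \<in> maps A n n"
    by (auto simp: all_bijections_def bijections_def)
  let ?F = "{unary A \<alpha>, unary A \<beta>, TG A 2 \<alpha> 1, TG A 2 \<beta> 1}"
  let ?T = "generated A ?F"
  interpret circuits A ?T n using circuits_generated[OF n] .
  have "\<alpha> permutes {1..k}" "\<beta> permutes {1, 2}"
    using cycle_permutes[of "[1..<k + 1]"] cycle_permutes[of "[1::nat, 2]"]
    by (simp_all add: assms(4,5) atLeastLessThanSuc_atLeastAtMost del: upt_Suc)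
  then have perm: "\<alpha> ` A \<subseteq> A" "\<beta> ` A \<subseteq> A"
    using assms(2,3) permutes_subset[of \<beta> "{1, 2}" A] by (auto dest: permutes_image)
  have gens: "unary A \<alpha> \<in> ?T" "unary A \<beta> \<in> ?T" "TG A 2 \<alpha> 1 \<in> ?T" "TG A 2 \<beta> 1 \<in> ?T"
    unfolding generated_def by (rule subsetD[OF hull_subset], simp)+
  note span = transpose_closed[of _ k, folded assms(3-5)]
  have k: "k \<ge> 2" using assms(2) by simp
  have "gate1 \<alpha>" "gate1 \<beta>"
    using gate1_unary[OF gens(1) perm(1)] gate1_unary[OF gens(2) perm(2)] .
  then have t1: "gate1 (transpose a b)" if "a \<in> A" "b \<in> A" for a b
    using span[of gate1, OF gate1_comp _ _ k that] by blast
  let ?ctrl = "\<lambda>\<sigma> v. if v = 1 then \<sigma> else id"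
  have comp: "gate2 (?ctrl (p \<circ> q))" if "gate2 (?ctrl p)" "gate2 (?ctrl q)" for p q
    using gate2_comp[OF that] by (rule gate2_cong) simp
  have "gate2 (?ctrl \<alpha>)" "gate2 (?ctrl \<beta>)"
    using gate2_TG[OF gens(3) perm(1)] gate2_TG[OF gens(4) perm(2)] .
  then have t2: "gate2 (?ctrl (transpose a b))" if "a \<in> A" "b \<in> A" for a b
    using span[of "\<lambda>\<sigma>. gate2 (?ctrl \<sigma>)", OF comp _ _ k that] by blast
  interpret transposition_circuits A ?T n 1
    using assms(2,3) t1 t2 by unfold_locales auto
  have "arity g = n" "coarity g = n" "g \<in> all_maps A"
    using g n by (auto simp: maps_def all_maps_def)
  with maps_computed[OF g] show "realised A ?F g"
    by (simp add: realised_def)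
qed

end
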